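(* Let $\lambda\in(0,1]$ and let $\mu\in\mathbb{C}$ satisfy $|1-\mu|<\lambda$. Then all members of the family $\mathcal{U}(\lambda,\mu)$ are functions meromorphic and locally univalent in $\mathbb{D}$ if and only if $|\mu|\ge\lambda$.
   Context: $\mathbb{D}=\{z\in\mathbb{C}:|z|<1\}$. For $\lambda>0$ and $\mu\in\mathbb{C}$ with $|1-\mu|<\lambda$, $\mathcal{U}(\lambda,\mu)$ denotes the family of all functions $f$ meromorphic in $\mathbb{D}$, normalized by $f(0)=f'(0)-1=0$, such that $|U_f(z)-\mu|<\lambda$ for all $z\in\mathbb{D}$, where $$U_f(z)=\left(\frac{z}{f(z)}\right)^2 f'(z)=\frac{z}{f(z)}-z\left(\frac{z}{f(z)}\right)',$$ understood with removable singularities removed (at $z=0$, where $z/f(z)$ takes the value $1$, and at the poles of $f$, where $z/f(z)$ takes the value $0$). A meromorphic function in $\mathbb{D}$ is locally univalent if every point of $\mathbb{D}$ has a neighborhood on which it is injective as a map into the Riemann sphere $\mathbb{C}\cup\{\infty\}$. *)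

theory Defs
  imports "HOL-Complex_Analysis.Complex_Analysis"
begin

text \<open>
  Meromorphic functions are represented by nicely meromorphic ones: removable singularities are
  filled in, and at a pole the function carries the dummy value 0. The points of the Riemann
  sphere are rendered as \<^typ>\<open>complex option\<close>, with \<^const>\<open>None\<close> as the point at infinity.
\<close>

definition sphere_value :: "(complex \<Rightarrow> complex) \<Rightarrow> complex \<Rightarrow> complex option" where
  "sphere_value f z = (if is_pole f z then None else Some (f z))"

definition locally_univalent_on :: "(complex \<Rightarrow> complex) \<Rightarrow> complex set \<Rightarrow> bool" where
  "locally_univalent_on f A \<longleftrightarrow>
     (\<forall>z\<in>A. \<exists>V. open V \<and> z \<in> V \<and> V \<subseteq> A \<and> inj_on (sphere_value f) V)"

definition U_op :: "(complex \<Rightarrow> complex) \<Rightarrow> complex \<Rightarrow> complex" where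
  "U_op f = remove_sings (\<lambda>w. (w / f w) ^ 2 * deriv f w)"

text \<open>
  Having derivative 1 at 0 makes \<^term>\<open>f\<close> continuous there, so that \<open>f 0 = 0\<close> is a genuine value
  and not the dummy value at a pole. A zero of \<^term>\<open>f\<close> other than 0 is a pole of
  \<^term>\<open>U_op f\<close>; the inequality presupposes that there is none.
\<close>

definition U_family :: "real \<Rightarrow> complex \<Rightarrow> (complex \<Rightarrow> complex) set" where
  "U_family l \<mu> = {f. f nicely_meromorphic_on ball 0 1 \<and>
     f 0 = 0 \<and> (f has_field_derivative 1) (at 0) \<and>
     (\<forall>z\<in>ball 0 1. \<not> is_pole (U_op f) z \<and> norm (U_op f z - \<mu>) < l)}"

end

theory Submission
  imports Defs
begin

text \<open>
  If \<open>|\<mu>| \<ge> \<lambda>\<close>, then \<open>U_f\<close> has no zeros. Away from the poles of \<open>f\<close> this forces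
  \<open>f' \<noteq> 0\<close>, and near a pole \<open>U_f = - z\<^sup>2 (1/f)'\<close> forces \<open>(1/f)' \<noteq> 0\<close>.

  Conversely, if \<open>f = z/p\<close> then \<open>U_f = p - z p'\<close>, so a prescribed \<open>U_f\<close> with \<open>U_f - 1 = O(z\<^sup>2)\<close> can
  be realised by integration. If \<open>|\<mu>| < \<lambda>\<close>, take \<open>U_f = \<mu> + \<lambda> \<omega>(z\<^sup>2)\<close>, where \<open>\<omega>\<close> is a disc
  automorphism with \<open>\<omega>(0) = (1 - \<mu>)/\<lambda>\<close>. It takes the value \<open>-\<mu>/\<lambda>\<close> at some \<open>\<zeta>\<^sup>2\<close>, and then \<open>\<zeta>\<close>
  is a critical point of \<open>f\<close>, provided that \<open>p(\<zeta>) \<noteq> 0\<close>.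
\<close>

section \<open>Local univalence where \<open>U_op f\<close> does not vanish\<close>

text \<open>\<open>remove_sings\<close> returns the limit where one exists, so a continuous
  \<open>q\<close> determines \<open>U_op f z\<close> even where the raw formula is falsified by a
  dummy value or by division by zero.\<close>

lemma U_op_eqI:
  assumes "\<forall>\<^sub>F w in at z. (w / f w)\<^sup>2 * deriv f w = q w" and "isCont q z"
  shows "U_op f z = q z"
  unfolding U_op_def
proof (rule remove_sings_eqI)
  have "q \<midarrow>z\<rightarrow> q z"
    using assms(2) by (rule isContD)
  then show "(\<lambda>w. (w / f w)\<^sup>2 * deriv f w) \<midarrow>z\<rightarrow> q z"
    using tendsto_cong[OF assms(1)] by simp
qed

text \<open>Where \<open>f z \<noteq> 0\<close> the defining formula is continuous, so a zero of
  \<open>f'\<close> would be a zero of \<open>U_op f\<close>. A zero of \<open>f\<close> at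
  \<open>z \<noteq> 0\<close> is excluded altogether: \<open>f'/f\<close> would have a pole there,
  yet near \<open>z\<close> it equals \<open>U_op f * f / z^2\<close>, which is analytic.\<close>

lemma deriv_nonzero_if_U_op_nonzero:
  assumes f: "f analytic_on {z}" and "z \<noteq> 0"
    and U: "\<not> is_pole (U_op f) z" "U_op f z \<noteq> 0"
  shows "deriv f z \<noteq> 0"
proof
  assume d0: "deriv f z = 0"
  define h where "h = (\<lambda>w. (w / f w)\<^sup>2 * deriv f w)"
  have fm: "f meromorphic_on {z}"
    using f by (rule analytic_on_imp_meromorphic_on)
  have hm: "h meromorphic_on {z}"
    unfolding h_def by (intro meromorphic_intros fm)
  have Uh: "U_op f = remove_sings h"
    by (simp add: U_op_def h_def fun_eq_iff)
  have Ua: "U_op f analytic_on {z}"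
    using remove_sings_nicely_meromorphic[OF hm] nicely_meromorphic_on_imp_analytic_at U(1)
    unfolding Uh by blast
  have df: "deriv f analytic_on {z}"
    using f by (rule analytic_deriv)
  show False
  proof (cases "f z = 0")
    case False
    have "isCont h z"
      unfolding h_def using f df False
      by (intro continuous_intros analytic_at_imp_isCont) auto
    then have "U_op f z = h z"
      by (intro U_op_eqI) (auto simp: h_def)
    then show False
      using U(2) d0 by (simp add: h_def)
  next
    case True
    have nz: "\<forall>\<^sub>F w in at z. f w \<noteq> 0"
    proof (rule ccontr)
      assume "\<not> ?thesis"
      then have "\<forall>\<^sub>F w in at z. f w = 0"
        using non_isolated_zero_imp_eventually_zero[OF f True] unfolding isolated_zero_def by blast
      \<comment> \<open>Division by zero yields 0, so the formula vanishes wherever \<open>f\<close>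
        does.\<close>
      then have "\<forall>\<^sub>F w in at z. (w / f w)\<^sup>2 * deriv f w = (\<lambda>_. 0) w"
        by eventually_elim auto
      then have "U_op f z = 0"
        by (rule U_op_eqI) auto
      then show False using U(2) by simp
    qed
    obtain F where F: "(\<lambda>w. f (z + w)) has_laurent_expansion F"
      using fm by (auto simp: meromorphic_on_def)
    have "F \<noteq> 0"
    proof
      assume "F = 0"
      then have "\<forall>\<^sub>F w in at z. f w = 0"
        using F has_laurent_expansion_eventually_zero_iff by blast
      with nz have "\<forall>\<^sub>F w in at z. False"
        by eventually_elim auto
      then show False by simp
    qed
    moreover have "f \<midarrow>z\<rightarrow> 0"
      using analytic_at_imp_isCont[OF f] True by (metis isContD)
    ultimately have pole: "is_pole (\<lambda>w. deriv f w / f w) z"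
      using is_pole_deriv_divide_iff[OF F] by blast
    have "\<forall>\<^sub>F w in at z. U_op f w = h w"
      unfolding Uh using hm by (intro eventually_remove_sings_eq_at) (simp add: meromorphic_at_iff)
    moreover have "\<forall>\<^sub>F w in at z. w \<noteq> 0"
      using \<open>z \<noteq> 0\<close> eventually_neq_at_within by blast
    ultimately have "\<forall>\<^sub>F w in at z. U_op f w * f w / w\<^sup>2 = deriv f w / f w"
      using nz by eventually_elim (simp add: h_def power2_eq_square field_simps)
    then have "is_pole (\<lambda>w. U_op f w * f w / w\<^sup>2) z"
      using is_pole_cong[OF _ refl] pole by metis
    moreover have "(\<lambda>w. U_op f w * f w / w\<^sup>2) analytic_on {z}"
      using Ua f \<open>z \<noteq> 0\<close> by (auto intro!: analytic_intros)
    ultimately show False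
      using analytic_at_imp_no_pole by blast
  qed
qed

lemma locally_injective_at_regular_point:
  assumes f: "f analytic_on {z}" and "deriv f z \<noteq> 0" and "open A" "z \<in> A"
  shows "\<exists>V. open V \<and> z \<in> V \<and> V \<subseteq> A \<and> inj_on (sphere_value f) V"
proof -
  obtain S where S: "open S" "z \<in> S" "f holomorphic_on S"
    using f analytic_at by blast
  have "f holomorphic_on (S \<inter> A)"
    using S(3) by (rule holomorphic_on_subset) auto
  moreover have "open (S \<inter> A)" "z \<in> S \<inter> A"
    using S assms by auto
  ultimately obtain r where r: "r > 0" "ball z r \<subseteq> S \<inter> A" "inj_on f (ball z r)"
    using has_complex_derivative_locally_injective assms(2) by metis
  have "\<not> is_pole f w" if "w \<in> ball z r" for w
    using that r S not_is_pole_holomorphic by blast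
  then have "inj_on (sphere_value f) (ball z r)"
    using r(3) by (auto simp: inj_on_def sphere_value_def)
  with r show ?thesis
    by (intro exI[of _ "ball z r"]) auto
qed

text \<open>In the coordinate \<open>g = 1/f\<close> the pole is a regular point: the formula for
  \<open>U_op f\<close> becomes \<open>- z^2 g'\<close>, so \<open>g\<close> has nonzero derivative
  at \<open>z\<close> and is injective nearby. With no further pole in the neighbourhood, only
  \<open>z\<close> goes to \<open>None\<close>, and injectivity passes to
  \<open>sphere_value f\<close>.\<close>

lemma locally_injective_at_pole:
  assumes f: "f nicely_meromorphic_on A" and A: "open A" "z \<in> A"
    and pole: "is_pole f z" and U: "U_op f z \<noteq> 0"
  shows "\<exists>V. open V \<and> z \<in> V \<and> V \<subseteq> A \<and> inj_on (sphere_value f) V"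
proof -
  define g where "g = (\<lambda>w. inverse (f w))"
  \<comment> \<open>The dummy value fits: \<open>inverse 0 = 0\<close> is the limit of
    \<open>1/f\<close> at a pole, so \<open>g\<close> needs no correction at
    \<open>z\<close>.\<close>
  have g_nice: "g nicely_meromorphic_on A"
    unfolding g_def by (intro meromorphic_intros f)
  have "\<not> is_pole g z"
    unfolding g_def using pole pole_is_not_zero by (simp add: is_pole_inverse_iff)
  then have g: "g analytic_on {z}"
    using g_nice A nicely_meromorphic_on_imp_analytic_at by blast
  have "isolated_singularity_at f z"
    using f A(2) by (simp add: nicely_meromorphic_on_def meromorphic_on_altdef)
  then have np: "\<forall>\<^sub>F w in at z. \<not> is_pole f w"
    by (rule eventually_not_pole)
  have "\<forall>\<^sub>F w in at z. (w / f w)\<^sup>2 * deriv f w = - (w\<^sup>2 * deriv g w)"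
    using np non_zero_neighbour_pole[OF pole] eventually_at_in_open'[OF A]
  proof eventually_elim
    case (elim w)
    have "f analytic_on {w}"
      using f elim nicely_meromorphic_on_imp_analytic_at by blast
    then have "(f has_field_derivative deriv f w) (at w)"
      using analytic_on_imp_differentiable_at DERIV_deriv_iff_field_differentiable by blast
    then have "(g has_field_derivative - (deriv f w / (f w)\<^sup>2)) (at w)"
      unfolding g_def using elim
      by (auto intro!: derivative_eq_intros simp: power2_eq_square field_simps)
    then have "deriv g w = - (deriv f w / (f w)\<^sup>2)"
      by (rule DERIV_imp_deriv)
    then show ?case
      by (simp add: power_divide)
  qed
  moreover have "isCont (\<lambda>w. - (w\<^sup>2 * deriv g w)) z"
    by (intro continuous_intros analytic_at_imp_isCont analytic_deriv g)
  ultimately have "U_op f z = - (z\<^sup>2 * deriv g z)"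
    by (rule U_op_eqI)
  with U have dg: "deriv g z \<noteq> 0"
    by auto
  obtain S where S: "open S" "z \<in> S" "g holomorphic_on S"
    using g analytic_at by blast
  obtain T where T: "open T" "z \<in> T" "\<And>w. w \<in> T \<Longrightarrow> w \<noteq> z \<Longrightarrow> \<not> is_pole f w"
    using np unfolding eventually_at_topological by blast
  have "g holomorphic_on (S \<inter> T \<inter> A)"
    using S(3) by (rule holomorphic_on_subset) auto
  moreover have "open (S \<inter> T \<inter> A)" "z \<in> S \<inter> T \<inter> A"
    using S T A by auto
  ultimately obtain r where r: "r > 0" "ball z r \<subseteq> S \<inter> T \<inter> A" "inj_on g (ball z r)"
    using has_complex_derivative_locally_injective dg by metis
  have "is_pole f w \<longleftrightarrow> w = z" if "w \<in> ball z r" for w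
    using that r T pole by blast
  then have "inj_on (sphere_value f) (ball z r)"
    using r(3) unfolding inj_on_def sphere_value_def g_def by (simp split: if_splits)
  with r show ?thesis
    by (intro exI[of _ "ball z r"]) auto
qed

lemma U_family_locally_univalent:
  assumes f: "f \<in> U_family l \<mu>" and \<mu>: "norm \<mu> \<ge> l"
  shows "locally_univalent_on f (ball 0 1)"
  unfolding locally_univalent_on_def
proof
  fix z :: complex assume z: "z \<in> ball 0 1"
  have nice: "f nicely_meromorphic_on ball 0 1"
    and f1: "(f has_field_derivative 1) (at 0)"
    and U: "\<not> is_pole (U_op f) z" "norm (U_op f z - \<mu>) < l"
    using f z by (auto simp: U_family_def)
  have U0: "U_op f z \<noteq> 0"
    using U(2) \<mu> by auto
  show "\<exists>V. open V \<and> z \<in> V \<and> V \<subseteq> ball 0 1 \<and> inj_on (sphere_value f) V"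
  proof (cases "is_pole f z")
    case True
    then show ?thesis
      using locally_injective_at_pole[OF nice _ z _ U0] by simp
  next
    case False
    then have "f analytic_on {z}"
      using nicely_meromorphic_on_imp_analytic_at nice z by blast
    \<comment> \<open>At the origin the factor \<open>z^2\<close> prevents reading \<open>f'\<close>
      off \<open>U_op f\<close>; there the normalization supplies the derivative 1.\<close>
    moreover from this have "deriv f z \<noteq> 0"
      using deriv_nonzero_if_U_op_nonzero[OF _ _ U(1) U0] DERIV_imp_deriv[OF f1]
      by (cases "z = 0") auto
    ultimately show ?thesis
      using z by (intro locally_injective_at_regular_point) auto
  qed
qed

section \<open>Functions of the form \<open>z / p z\<close>\<close>

text \<open>Multiplying \<open>1/p\<close> by \<open>z\<close> keeps its poles and their dummy
  values 0, because \<open>p 0 \<noteq> 0\<close> prevents a pole at the origin that the factor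
  \<open>z\<close> could cancel.\<close>

lemma nicely_meromorphic_on_id_divide:
  assumes "p analytic_on A" and "p 0 \<noteq> 0"
  shows "(\<lambda>z. z / p z) nicely_meromorphic_on A"
proof -
  have inv: "(\<lambda>z. inverse (p z)) nicely_meromorphic_on A"
    using assms(1) by (intro meromorphic_intros analytic_on_imp_nicely_meromorphic_on)
  have "is_pole (\<lambda>z. z / p z) z \<and> z / p z = 0 \<or> (\<lambda>z. z / p z) \<midarrow>z\<rightarrow> z / p z" if z: "z \<in> A" for z
  proof -
    have "is_pole (\<lambda>z. inverse (p z)) z \<and> inverse (p z) = 0 \<or>
          (\<lambda>z. inverse (p z)) \<midarrow>z\<rightarrow> inverse (p z)"
      using inv z by (auto simp: nicely_meromorphic_on_def)
    then show ?thesis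
    proof
      assume P: "is_pole (\<lambda>z. inverse (p z)) z \<and> inverse (p z) = 0"
      then have "z \<noteq> 0"
        using assms(2) by auto
      with P have "is_pole (\<lambda>z. z * inverse (p z)) z"
        by (intro is_pole_mult_analytic_nonzero1) auto
      with P show ?thesis
        by (simp add: divide_inverse)
    next
      assume "(\<lambda>z. inverse (p z)) \<midarrow>z\<rightarrow> inverse (p z)"
      then have "(\<lambda>z. z * inverse (p z)) \<midarrow>z\<rightarrow> z * inverse (p z)"
        by (rule tendsto_mult[OF tendsto_ident_at])
      then show ?thesis
        by (simp add: divide_inverse)
    qed
  qed
  moreover have "(\<lambda>z. z / p z) meromorphic_on A"
    using assms(1) by (intro meromorphic_intros analytic_on_imp_meromorphic_on)
  ultimately show ?thesis
    unfolding nicely_meromorphic_on_def by blast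
qed

lemma has_field_derivative_id_divide:
  fixes p :: "complex \<Rightarrow> complex"
  assumes "(p has_field_derivative p') (at z)" and "p z \<noteq> 0"
  shows "((\<lambda>z. z / p z) has_field_derivative (p z - z * p') / (p z)\<^sup>2) (at z)"
  using DERIV_divide[OF DERIV_ident assms] by (simp add: power2_eq_square)

text \<open>Where \<open>z\<close> and \<open>p\<close> are nonzero, the quotient rule gives
  \<open>p^2 * (p - z p') / p^2\<close>. By the identity theorem and \<open>p 0 = 1\<close> the
  zeros of \<open>p\<close> are isolated, so continuity extends the formula to them and to the
  origin.\<close>

lemma U_op_id_divide:
  assumes p: "p holomorphic_on A" and A: "open A" "connected A" "0 \<in> A" "z \<in> A"
    and p0: "p 0 = 1"
  shows "U_op (\<lambda>z. z / p z) z = p z - z * deriv p z"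
proof (rule U_op_eqI)
  have pa: "p analytic_on A"
    using p A(1) by (simp add: analytic_on_open)
  have nz: "\<forall>\<^sub>F w in at z. p w \<noteq> 0"
  proof (rule ccontr)
    assume "\<not> ?thesis"
    then have "\<exists>\<^sub>F w in at z. p w = 0"
      by (simp add: not_eventually)
    then have "p w = 0" if "w \<in> A" for w
      using frequently_eq_meromorphic_imp_constant[OF _ analytic_on_imp_nicely_meromorphic_on[OF pa] A(1,2,4) that]
      by blast
    then show False
      using p0 A(3) by force
  qed
  show "\<forall>\<^sub>F w in at z. (w / (w / p w))\<^sup>2 * deriv (\<lambda>z. z / p z) w = p w - w * deriv p w"
    using nz eventually_at_in_open'[OF A(1,4)] eventually_neq_at_within[of 0]
  proof eventually_elim
    case (elim w)
    have "(p has_field_derivative deriv p w) (at w)"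
      using p A(1) elim by (intro holomorphic_derivI)
    then have "deriv (\<lambda>z. z / p z) w = (p w - w * deriv p w) / (p w)\<^sup>2"
      using elim by (intro DERIV_imp_deriv has_field_derivative_id_divide) auto
    then show ?case
      using elim by simp
  qed
  have "(\<lambda>w. p w - w * deriv p w) analytic_on {z}"
    by (intro analytic_intros analytic_deriv analytic_on_subset[OF pa]) (use A in auto)
  then show "isCont (\<lambda>w. p w - w * deriv p w) z"
    by (rule analytic_at_imp_isCont)
qed

text \<open>Membership is reduced to an inequality for \<open>p - z p'\<close>. Zeros of
  \<open>p\<close> are allowed; they become poles of the quotient.\<close>

lemma id_divide_in_U_family:
  assumes p: "p holomorphic_on ball 0 1" and p0: "p 0 = 1"
    and U: "\<And>z. norm z < 1 \<Longrightarrow> norm (p z - z * deriv p z - \<mu>) < l"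
  shows "(\<lambda>z. z / p z) \<in> U_family l \<mu>"
proof -
  let ?f = "\<lambda>z. z / p z" and ?q = "\<lambda>z. p z - z * deriv p z"
  have pa: "p analytic_on ball 0 1"
    using p by (simp add: analytic_on_open)
  have Uq: "U_op ?f z = ?q z" if "z \<in> ball 0 1" for z
    using p p0 that by (intro U_op_id_divide[where A = "ball 0 1"]) auto
  have "\<not> is_pole (U_op ?f) z" if z: "z \<in> ball 0 1" for z
  proof (rule not_is_pole_holomorphic[OF open_ball z])
    have "?q holomorphic_on ball 0 1"
      by (intro holomorphic_intros p) auto
    then show "U_op ?f holomorphic_on ball 0 1"
      by (rule holomorphic_transform) (simp add: Uq)
  qed
  moreover have "(?f has_field_derivative 1) (at 0)"
    using has_field_derivative_id_divide[OF holomorphic_derivI[OF p], of 0] p0 by simp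
  ultimately show ?thesis
    using nicely_meromorphic_on_id_divide[OF pa] p0 U Uq by (simp add: U_family_def)
qed

section \<open>A member of the family with a critical point\<close>

lemma not_locally_univalent_if_critical_point:
  assumes f: "f analytic_on {z}" and "deriv f z = 0" "z \<in> A"
  shows "\<not> locally_univalent_on f A"
proof
  assume "locally_univalent_on f A"
  then obtain V where V: "open V" "z \<in> V" "inj_on (sphere_value f) V"
    using assms(3) unfolding locally_univalent_on_def by blast
  obtain S where S: "open S" "z \<in> S" "f holomorphic_on S"
    using f analytic_at by blast
  have "\<not> is_pole f w" if "w \<in> S" for w
    using that S not_is_pole_holomorphic by blast
  then have "inj_on f (S \<inter> V)"
    using V(3) by (auto simp: inj_on_def sphere_value_def)
  moreover have "f holomorphic_on (S \<inter> V)"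
    using S(3) by (rule holomorphic_on_subset) auto
  ultimately have "deriv f z \<noteq> 0"
    using holomorphic_injective_imp_regular[of f "S \<inter> V" z] V S by auto
  with assms(2) show False by simp
qed

lemma exists_U_family_member_not_locally_univalent:
  fixes l :: real and \<mu> :: complex
  assumes l: "0 < l" and \<mu>1: "norm (1 - \<mu>) < l" and \<mu>: "norm \<mu> < l"
  shows "\<exists>f\<in>U_family l \<mu>. \<not> locally_univalent_on f (ball 0 1)"
proof -
  \<comment> \<open>\<open>c\<close> and \<open>d\<close> are the values of \<open>\<omega>\<close>
    that make \<open>\<mu> + l * \<omega>\<close> equal to 1 and to 0. They differ by
    \<open>1/l\<close>.\<close>
  define c where "c = (1 - \<mu>) / l"
  define d where "d = - \<mu> / l"
  \<comment> \<open>The Moebius functions with parameters \<open>c\<close> and \<open>-c\<close> are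
    mutually inverse, so \<open>q\<close> is the point that \<open>\<omega>\<close> sends to
    \<open>d\<close>.\<close>
  define q where "q = Moebius_function 0 c d"
  define \<omega> where "\<omega> = Moebius_function 0 (- c)"
  define \<zeta> where "\<zeta> = csqrt q"
  have c: "norm c < 1" and d: "norm d < 1" and "c \<noteq> d"
    using assms by (auto simp: c_def d_def norm_divide field_simps)
  have \<omega>q: "\<omega> q = d"
    unfolding \<omega>_def q_def using c d by (intro Moebius_function_compose) auto
  have "norm q < 1"
    unfolding q_def using c d by (rule Moebius_function_norm_lt_1)
  then have \<zeta>: "norm \<zeta> < 1" "\<zeta>\<^sup>2 = q"
    by (auto simp: \<zeta>_def norm_csqrt)
  have \<omega>0: "\<omega> 0 = c"
    by (simp add: \<omega>_def Moebius_function_of_zero)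
  have "q \<noteq> 0"
    using \<omega>q \<omega>0 \<open>c \<noteq> d\<close> by auto
  then have "\<zeta> \<noteq> 0"
    using \<zeta>(2) by auto
  have sq: "norm (z\<^sup>2) < 1" if "norm z < 1" for z :: complex
    using that by (simp add: norm_power power_less_one_iff)
  have den: "1 + cnj c * z\<^sup>2 \<noteq> 0" if "norm z < 1" for z
  proof
    assume "1 + cnj c * z\<^sup>2 = 0"
    then have "cnj c * z\<^sup>2 = - 1"
      by (simp add: eq_neg_iff_add_eq_0 add.commute)
    then have "norm c * norm (z\<^sup>2) = 1"
      by (metis norm_mult complex_mod_cnj norm_minus_cancel norm_one)
    moreover have "norm c * norm (z\<^sup>2) < 1"
      using norm_mult_less[OF c sq[OF that]] by (simp add: norm_mult)
    ultimately show False by simp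
  qed
  have "(\<lambda>z. 1 / (1 + cnj c * z\<^sup>2)) holomorphic_on ball 0 1"
    using den by (intro holomorphic_intros) auto
  then obtain G0 where G0: "\<And>z. z \<in> ball 0 1 \<Longrightarrow>
      (G0 has_field_derivative 1 / (1 + cnj c * z\<^sup>2)) (at z within ball 0 1)"
    using holomorphic_convex_primitive'[OF convex_ball open_ball] by blast
  \<comment> \<open>Fixing the constant of integration at \<open>\<zeta>\<close> instead of 0 gives \<open>p(\<zeta>) = 1\<close>.\<close>
  define G where "G z = G0 z - G0 \<zeta>" for z
  have G: "(G has_field_derivative 1 / (1 + cnj c * z\<^sup>2)) (at z)" if "norm z < 1" for z
    unfolding G_def using G0[of z] that
    by (auto intro!: derivative_eq_intros simp: at_within_open[OF _ open_ball])
  \<comment> \<open>This is the factor in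
    \<open>l * (\<omega> (z^2) - c) = k * z^2 / (1 + cnj c * z^2)\<close>, the prescribed value of
    \<open>U_op f - 1\<close>.\<close>
  define k where "k = l * (1 - cnj c * c)"
  \<comment> \<open>Since \<open>p - z p' = - z^2 (p/z)'\<close>, integration yields
    \<open>p\<close>. It is determined only up to a multiple of \<open>z\<close>, which leaves
    \<open>p - z p'\<close> unchanged.\<close>
  define p where "p z = 1 - k * z * G z" for z
  have p': "(p has_field_derivative - k * G z - k * z / (1 + cnj c * z\<^sup>2)) (at z)"
    if "norm z < 1" for z
    unfolding p_def by (auto intro!: derivative_eq_intros G that simp: algebra_simps)
  have p: "p holomorphic_on ball 0 1"
    unfolding holomorphic_on_open[OF open_ball] using p' by (metis mem_ball_0)
  have Up: "p z - z * deriv p z = \<mu> + l * \<omega> (z\<^sup>2)" if "norm z < 1" for z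
  proof -
    have "p z - z * deriv p z = 1 + k * z\<^sup>2 / (1 + cnj c * z\<^sup>2)"
      by (simp add: DERIV_imp_deriv[OF p'[OF that]] p_def algebra_simps power2_eq_square)
    also have "\<dots> = (1 - l * c) + l * ((z\<^sup>2 + c) / (1 + cnj c * z\<^sup>2))"
      using den[OF that] by (simp add: k_def field_simps)
    also have "\<dots> = \<mu> + l * \<omega> (z\<^sup>2)"
      using l by (simp add: \<omega>_def Moebius_function_simple c_def)
    finally show ?thesis .
  qed
  have "norm (p z - z * deriv p z - \<mu>) < l" if "norm z < 1" for z
  proof -
    have "norm (\<omega> (z\<^sup>2)) < 1"
      unfolding \<omega>_def using c sq[OF that] by (intro Moebius_function_norm_lt_1) auto
    then show ?thesis
      using l by (simp add: Up[OF that] norm_mult)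
  qed
  moreover have "p 0 = 1"
    by (simp add: p_def)
  ultimately have mem: "(\<lambda>z. z / p z) \<in> U_family l \<mu>"
    using p by (intro id_divide_in_U_family)
  have p\<zeta>: "p \<zeta> = 1"
    by (simp add: p_def G_def)
  \<comment> \<open>The value is \<open>\<mu> + l * d = 0\<close>. It is the numerator of the
    derivative of \<open>z / p z\<close> at \<open>\<zeta>\<close>, whose denominator is 1.\<close>
  have "p \<zeta> - \<zeta> * deriv p \<zeta> = 0"
    using Up[OF \<zeta>(1)] l by (simp add: \<zeta>(2) \<omega>q d_def)
  then have "((\<lambda>z. z / p z) has_field_derivative 0) (at \<zeta>)"
    using has_field_derivative_id_divide[OF holomorphic_derivI[OF p], of \<zeta>] p\<zeta> \<zeta>(1) by simp
  then have "deriv (\<lambda>z. z / p z) \<zeta> = 0"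
    by (rule DERIV_imp_deriv)
  moreover have "p analytic_on {\<zeta>}"
    using p \<zeta>(1) analytic_at[of p \<zeta>] by (metis mem_ball_0 open_ball)
  then have "(\<lambda>z. z / p z) analytic_on {\<zeta>}"
    using p\<zeta> by (auto intro!: analytic_intros)
  ultimately have "\<not> locally_univalent_on (\<lambda>z. z / p z) (ball 0 1)"
    using \<zeta>(1) by (intro not_locally_univalent_if_critical_point) auto
  with mem show ?thesis by blast
qed

theorem theorem1:
  fixes l :: real and \<mu> :: complex
  assumes "0 < l" and "l \<le> 1" and "norm (1 - \<mu>) < l"
  shows "(\<forall>f\<in>U_family l \<mu>. f nicely_meromorphic_on ball 0 1 \<and> locally_univalent_on f (ball 0 1))
           \<longleftrightarrow> norm \<mu> \<ge> l"
proof
  assume "norm \<mu> \<ge> l"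
  then show "\<forall>f\<in>U_family l \<mu>. f nicely_meromorphic_on ball 0 1 \<and> locally_univalent_on f (ball 0 1)"
    using U_family_locally_univalent by (auto simp: U_family_def)
next
  assume "\<forall>f\<in>U_family l \<mu>. f nicely_meromorphic_on ball 0 1 \<and> locally_univalent_on f (ball 0 1)"
  then show "norm \<mu> \<ge> l"
    using exists_U_family_member_not_locally_univalent[OF assms(1,3)] by (meson not_le)
qed

end
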